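(* Let $\{M_0(t)\}_{t\ge0}$ and $\{M(t)\}_{t\ge0}$ be independent generalized counting processes with positive rates $\mu_1,\dots,\mu_{k_0}$ and $\lambda_1,\dots,\lambda_k$, respectively, let $\hat M(t)=M(M_0(t))$ and $\mu=\sum_{j_0=1}^{k_0}\mu_{j_0}$. For $\alpha>0$ let $$\hat{\mathcal X}^\alpha(t)=\frac{1}{\Gamma(\alpha)}\int_0^t(t-s)^{\alpha-1}\hat M(s)\,\mathrm{d}s .$$ Then, for $t>0$ and $n\ge0$, $$\mathbb{E}\big(\hat{\mathcal X}^\alpha(t)\,\big|\,\hat M(t)=n\big)=\frac{1}{\Gamma(\alpha)}\sum_{r=0}^{n}\frac{r\,e^{-\mu t}}{\mathrm{Pr}\{\hat M(t)=n\}}\sum_{x=0}^{\infty}\mathrm{Pr}\{M(x)=r\}\sum_{\Omega(k_0,x)}\Big(\prod_{j_0=1}^{k_0}\frac{\mu_{j_0}^{r_{j_0}}}{r_{j_0}!}\Big)\sum_{y=0}^{\infty}\mathrm{Pr}\{M(y)=n-r\}\sum_{\Omega(k_0,y)}\Big(\prod_{j_0=1}^{k_0}\frac{\mu_{j_0}^{l_{j_0}}}{l_{j_0}!}\Big)t^{\alpha+l+\rho}B(\rho+1,\alpha+l),$$ where the sums over $\Omega(k_0,x)$ and $\Omega(k_0,y)$ run over $(r_1,\dots,r_{k_0})\in\Omega(k_0,x)$ and $(l_1,\dots,l_{k_0})\in\Omega(k_0,y)$, $\rho=r_1+\dots+r_{k_0}$, $l=l_1+\dots+l_{k_0}$, and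 $B(a,b)$ denotes the beta function.
   Context: A generalized counting process (GCP) $\{M(t)\}_{t\ge0}$ with positive rates $\lambda_1,\dots,\lambda_k$ is a right-continuous $\mathbb{N}_0$-valued process with $M(0)=0$ and stationary independent increments, whose probability generating function is $\mathbb{E}(u^{M(t)})=\exp\big(-t\sum_{j=1}^{k}\lambda_j(1-u^j)\big)$, $|u|\le1$. The process $\hat M(t)=M(M_0(t))$ is called the iterated generalized counting process (IGCP), and $\hat{\mathcal X}^\alpha$ is its Riemann-Liouville fractional integral. $\Omega(k_0,x)=\{(r_1,\dots,r_{k_0})\in\mathbb{N}_0^{k_0}: r_1+2r_2+\dots+k_0r_{k_0}=x\}$. *)

theory Defs
  imports "HOL-Probability.Probability"
begin

text \<open>The increments are taken in \<^typ>\<open>int\<close>, since monotonicity of the paths is not part of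
  the definition and subtraction on \<^typ>\<open>nat\<close> truncates. Only the values \<open>M t\<close> with
  \<open>t \<ge> 0\<close> and the rates \<open>rate 1, \<dots>, rate k\<close> are relevant.\<close>

locale generalized_counting_process = prob_space P
  for P :: "'a measure" and k :: nat and rate :: "nat \<Rightarrow> real" and M :: "real \<Rightarrow> 'a \<Rightarrow> nat" +
  assumes k_pos: "1 \<le> k"
    and rate_pos: "\<And>j. j \<in> {1..k} \<Longrightarrow> 0 < rate j"
    and random_variable_at: "\<And>t. 0 \<le> t \<Longrightarrow> random_variable (count_space UNIV) (M t)"
    and right_continuous:
      "\<And>\<omega> t. \<omega> \<in> space P \<Longrightarrow> 0 \<le> t \<Longrightarrow> continuous (at_right t) (\<lambda>s. real (M s \<omega>))"
    and start_zero: "\<And>\<omega>. \<omega> \<in> space P \<Longrightarrow> M 0 \<omega> = 0"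
    and stationary_increments:
      "\<And>s t. 0 \<le> s \<Longrightarrow> 0 \<le> t \<Longrightarrow>
        distr P (count_space UNIV) (\<lambda>\<omega>. int (M (s + t) \<omega>) - int (M s \<omega>)) =
        distr P (count_space UNIV) (\<lambda>\<omega>. int (M t \<omega>))"
    and independent_increments:
      "\<And>(m :: nat) (\<tau> :: nat \<Rightarrow> real). 0 \<le> \<tau> 0 \<Longrightarrow> (\<And>i. i < m \<Longrightarrow> \<tau> i < \<tau> (Suc i)) \<Longrightarrow>
        indep_vars (\<lambda>_. count_space UNIV)
          (\<lambda>i \<omega>. int (M (\<tau> (Suc i)) \<omega>) - int (M (\<tau> i) \<omega>)) {..<m}"
    and probability_generating_function:
      "\<And>t (u :: real). 0 \<le> t \<Longrightarrow> \<bar>u\<bar> \<le> 1 \<Longrightarrow>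
        expectation (\<lambda>\<omega>. u ^ M t \<omega>) = exp (- t * (\<Sum>j=1..k. rate j * (1 - u ^ j)))"

text \<open>Two processes are independent if their sample paths are independent random elements of the
  product of copies of \<^typ>\<open>nat\<close> over the index set \<open>[0, \<infinity>)\<close>.\<close>

definition independent_processes ::
  "'a measure \<Rightarrow> (real \<Rightarrow> 'a \<Rightarrow> nat) \<Rightarrow> (real \<Rightarrow> 'a \<Rightarrow> nat) \<Rightarrow> bool" where
  "independent_processes P X Y \<longleftrightarrow>
     prob_space.indep_var P
       (\<Pi>\<^sub>M t\<in>{0..}. count_space UNIV) (\<lambda>\<omega>. \<lambda>t\<in>{0..}. X t \<omega>)
       (\<Pi>\<^sub>M t\<in>{0..}. count_space UNIV) (\<lambda>\<omega>. \<lambda>t\<in>{0..}. Y t \<omega>)"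

definition iterated_process ::
  "(real \<Rightarrow> 'a \<Rightarrow> nat) \<Rightarrow> (real \<Rightarrow> 'a \<Rightarrow> nat) \<Rightarrow> real \<Rightarrow> 'a \<Rightarrow> nat" where
  "iterated_process M M0 t \<omega> = M (real (M0 t \<omega>)) \<omega>"

definition riemann_liouville_integral :: "real \<Rightarrow> (real \<Rightarrow> real) \<Rightarrow> real \<Rightarrow> real" where
  "riemann_liouville_integral \<alpha> f t =
     1 / Gamma \<alpha> * (LBINT s:{0..t}. (t - s) powr (\<alpha> - 1) * f s)"

text \<open>The expectation of \<open>X\<close> under the conditional probability measure given the event
  \<open>A\<close> of positive probability.\<close>

definition expectation_given_event :: "'a measure \<Rightarrow> ('a \<Rightarrow> real) \<Rightarrow> 'a set \<Rightarrow> real" where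
  "expectation_given_event P X A = (LINT \<omega>|uniform_measure P A. X \<omega>)"

definition Omega :: "nat \<Rightarrow> nat \<Rightarrow> (nat \<Rightarrow> nat) set" where
  "Omega k x = {r \<in> {1..k} \<rightarrow>\<^sub>E UNIV. (\<Sum>j=1..k. j * r j) = x}"

end

theory Submission
  imports Defs
begin

text \<open>Independence of the two processes and of the increments of each of them gives, for \<open>s \<le> t\<close>,
  the joint law of \<open>Mhat s\<close> and \<open>Mhat t\<close> as a double series over the value \<open>x\<close> of \<open>M0 s\<close> and
  the increment \<open>y\<close> of \<open>M0\<close> over \<open>[s, t]\<close>. Comparing power series in the generating function writes
  the probabilities for \<open>M0\<close> as polynomials in \<open>s\<close> and \<open>t - s\<close> times exponentials whose product
  \<open>exp (- \<mu> t)\<close> does not depend on \<open>s\<close>. By Tonelli the expectation may be taken inside the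
  fractional integral, and every term of the resulting series is a scaled beta integral. All terms
  are nonnegative, so the computation takes place in \<^typ>\<open>ennreal\<close>; summability is needed only to
  return to real series.\<close>

section \<open>Power series and weights\<close>

text \<open>By strong induction, the difference of the two series starts at order \<open>n\<close>.
  Dividing by \<open>u ^ n\<close> leaves a power series that vanishes for
  \<open>u \<noteq> 0\<close>, so its limit at 0, which is the coefficient of order
  \<open>n\<close>, is zero.\<close>

lemma powser_unique_real:
  fixes p q :: "nat \<Rightarrow> real"
  assumes "0 < d"
    and p: "\<And>u. \<bar>u\<bar> < d \<Longrightarrow> (\<lambda>x. p x * u ^ x) sums F u"
    and q: "\<And>u. \<bar>u\<bar> < d \<Longrightarrow> (\<lambda>x. q x * u ^ x) sums F u"
  shows "p = q"
proof
  fix n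
  show "p n = q n"
  proof (induction n rule: less_induct)
    case (less n)
    define a where "a i = p i - q i" for i
    have a0: "a i = 0" if "i < n" for i
      using less[OF that] by (simp add: a_def)
    have "(\<lambda>i. a (i + n) * u ^ i) sums 0" if "u \<noteq> 0" "norm u < d" for u
    proof -
      have "(\<lambda>i. a i * u ^ i) sums 0"
        using sums_diff[OF p q, of u u] that by (simp add: a_def algebra_simps)
      then have "(\<lambda>i. a (i + n) * u ^ (i + n)) sums 0"
        using sums_iff_shift[of "\<lambda>i. a i * u ^ i" n 0] a0 by simp
      then have "(\<lambda>i. (a (i + n) * u ^ (i + n)) / u ^ n) sums (0 / u ^ n)"
        by (rule sums_divide)
      then show ?thesis
        using that by (simp add: power_add)
    qed
    then have "((\<lambda>_. 0) \<longlongrightarrow> a (0 + n)) (at (0 :: real))"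
      by (intro powser_limit_0_strong[where a = "\<lambda>i. a (i + n)", OF \<open>0 < d\<close>])
    then have "a (0 + n) = 0"
      using LIM_const_eq by metis
    then show ?case
      by (simp add: a_def)
  qed
qed

text \<open>Coordinates are indexed from 1, so \<open>r j \<le> j * r j \<le> x\<close> bounds every
  coordinate.\<close>

lemma finite_Omega: "finite (Omega k x)"
proof (rule finite_subset)
  show "Omega k x \<subseteq> {1..k} \<rightarrow>\<^sub>E {0..x}"
  proof
    fix r assume r: "r \<in> Omega k x"
    have "r j \<le> x" if "j \<in> {1..k}" for j
    proof -
      have "r j \<le> j * r j"
        using that by simp
      also have "\<dots> \<le> (\<Sum>j=1..k. j * r j)"
        using that by (intro member_le_sum) auto
      finally show ?thesis
        using r by (simp add: Omega_def)
    qed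
    then show "r \<in> {1..k} \<rightarrow>\<^sub>E {0..x}"
      using r by (auto simp: Omega_def PiE_def)
  qed
qed (simp add: finite_PiE)

text \<open>The exponential factors into one exponential series for each \<open>j\<close>.
  Multiplying these out gives a sum over all tuples \<open>r\<close>, and collecting the tuples of
  equal degree \<open>\<Sum>j. j * r j\<close> gives the coefficient of each power of
  \<open>u\<close>.\<close>

lemma Omega_series_sums:
  fixes v :: "nat \<Rightarrow> real"
  shows "(\<lambda>x. (\<Sum>r\<in>Omega k x. \<Prod>j=1..k. v j ^ r j / fact (r j)) * u ^ x) sums
    exp (\<Sum>j=1..k. v j * u ^ j)"
proof -
  let ?R = "{1..k} \<rightarrow>\<^sub>E (UNIV :: nat set)"
  let ?deg = "\<lambda>r. \<Sum>j=1..k. j * r j :: nat"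
  define f where "f j i = (v j * u ^ j) ^ i / fact i" for j i
  define F where "F r = (\<Prod>j=1..k. f j (r j))" for r
  have f_sums: "f j sums exp (v j * u ^ j)" for j
    using exp_converges[of "v j * u ^ j"] by (simp add: f_def[abs_def] field_simps)
  have f_norm: "summable (\<lambda>i. norm (f j i))" for j
    using summable_norm_exp[of "v j * u ^ j"] by (simp add: f_def field_simps)
  have f_infsum: "infsum (f j) UNIV = exp (v j * u ^ j)" for j
    using norm_summable_imp_has_sum[OF f_norm f_sums] by (rule infsumI)
  have f_abs: "(\<lambda>i. norm (f j i)) summable_on UNIV" for j
    using f_norm by (intro norm_summable_imp_summable_on) simp
  have F_infsum: "infsum F ?R = exp (\<Sum>j=1..k. v j * u ^ j)"
    unfolding F_def
    by (subst infsum_prod_PiE_abs) (simp_all add: f_abs[unfolded real_norm_def] f_infsum exp_sum)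
  \<comment> \<open>An unordered sum that does not exist has the default value 0, whereas this one
    is an exponential and hence nonzero.\<close>
  then have "F summable_on ?R"
    using infsum_not_exists[of F ?R] by force
  then have F: "(F has_sum exp (\<Sum>j=1..k. v j * u ^ j)) ?R"
    using F_infsum has_sum_infsum by metis
  \<comment> \<open>The degree of a tuple is recovered from the tuple, so the finite sets
    \<open>Omega k x\<close> partition all tuples and the sum may be taken fibre by fibre.\<close>
  have bij: "bij_betw snd (Sigma UNIV (Omega k)) ?R"
  proof (rule bij_betwI')
    show "snd p = snd q \<longleftrightarrow> p = q"
      if "p \<in> Sigma UNIV (Omega k)" "q \<in> Sigma UNIV (Omega k)" for p q
      using that by (cases p, cases q) (auto simp: Omega_def)
    show "snd p \<in> ?R" if "p \<in> Sigma UNIV (Omega k)" for p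
      using that by (cases p) (simp add: Omega_def)
    show "\<exists>p\<in>Sigma UNIV (Omega k). r = snd p" if "r \<in> ?R" for r
      using that by (intro bexI[of _ "(?deg r, r)"]) (simp_all add: Omega_def)
  qed
  have "((\<lambda>p. F (snd p)) has_sum exp (\<Sum>j=1..k. v j * u ^ j)) (Sigma UNIV (Omega k))"
    using F has_sum_reindex_bij_betw[OF bij, of F] by blast
  then have "((\<lambda>x. \<Sum>r\<in>Omega k x. F r) has_sum exp (\<Sum>j=1..k. v j * u ^ j)) UNIV"
    by (rule has_sum_Sigma') (auto intro!: has_sum_finiteI finite_Omega)
  moreover have "F r = (\<Prod>j=1..k. v j ^ r j / fact (r j)) * u ^ x" if "r \<in> Omega k x" for r x
  proof -
    have "(\<Prod>j=1..k. u ^ (j * r j)) = u ^ x"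
      using that by (simp add: Omega_def flip: power_sum)
    moreover have "f j (r j) = v j ^ r j / fact (r j) * u ^ (j * r j)" for j
      by (simp add: f_def power_mult_distrib power_mult)
    ultimately show ?thesis
      by (simp only: F_def prod.distrib)
  qed
  ultimately show ?thesis
    by (intro has_sum_imp_sums) (simp add: sum_distrib_right)
qed

text \<open>Absorbing \<open>t\<close> into \<open>v\<close> and setting \<open>u = 1\<close> turns
  this into the series of an exponential. It serves as the majorant for both series of the
  result.\<close>

lemma Omega_weight_summable:
  fixes v :: "nat \<Rightarrow> real"
  shows "summable (\<lambda>x. \<Sum>r\<in>Omega k x. (\<Prod>j=1..k. v j ^ r j / fact (r j)) * t ^ (\<Sum>j=1..k. r j))"
proof -
  have "(\<Prod>j=1..k. (v j * t) ^ r j / fact (r j)) =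
      (\<Prod>j=1..k. v j ^ r j / fact (r j)) * t ^ (\<Sum>j=1..k. r j)" for r :: "nat \<Rightarrow> nat"
    by (simp add: power_mult_distrib power_sum mult.commute flip: prod.distrib)
  then show ?thesis
    using Omega_series_sums[where k = k and v = "\<lambda>j. v j * t" and u = 1] by (simp add: sums_iff)
qed

section \<open>Beta integrals\<close>

text \<open>The substitution \<open>s = t * x\<close> reduces the claim to the beta integral over
  \<open>[0, 1]\<close>; the Jacobian supplies one further factor \<open>t\<close>. With a
  nonnegative integral, the singularity at \<open>s = t\<close> for \<open>b < 1\<close> needs no
  separate treatment.\<close>

lemma nn_integral_Beta_scaled:
  fixes m :: nat and b t :: real
  assumes b: "0 < b" and t: "0 < t"
  shows "(\<integral>\<^sup>+ s. ennreal (s ^ m * (t - s) powr (b - 1)) * indicator {0..t} s \<partial>lborel) =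
    ennreal (t powr (b + real m) * Beta (real m + 1) b)"
proof -
  let ?f = "\<lambda>x. x powr (real m + 1 - 1) * (1 - x) powr (b - 1)"
  have "(\<integral>\<^sup>+ s. ennreal (s ^ m * (t - s) powr (b - 1)) * indicator {0..t} s \<partial>lborel) =
      ennreal t * (\<integral>\<^sup>+ x. ennreal ((t * x) ^ m * (t - t * x) powr (b - 1)) * indicator {0..t} (t * x) \<partial>lborel)"
    using nn_integral_real_affine[where t = 0 and c = t and
        f = "\<lambda>s. ennreal (s ^ m * (t - s) powr (b - 1)) * indicator {0..t} s"] t by simp
  also have "(\<integral>\<^sup>+ x. ennreal ((t * x) ^ m * (t - t * x) powr (b - 1)) * indicator {0..t} (t * x) \<partial>lborel) =
      (\<integral>\<^sup>+ x. ennreal (t powr (b - 1 + real m)) * (ennreal (?f x) * indicator {0..1} x) \<partial>lborel)"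
  proof (rule nn_integral_cong_AE)
    \<comment> \<open>The point 0 is discarded because the integrands can differ there: for
      \<open>m = 0\<close> one has \<open>0 ^ 0 = 1\<close> but \<open>0 powr 0 = 0\<close>.\<close>
    show "AE x in lborel. ennreal ((t * x) ^ m * (t - t * x) powr (b - 1)) * indicator {0..t} (t * x) =
      ennreal (t powr (b - 1 + real m)) * (ennreal (?f x) * indicator {0..1} x)"
      using AE_lborel_singleton[of "0 :: real"]
    proof eventually_elim
      case (elim x)
      show ?case
      proof (cases "0 < x \<and> x \<le> 1")
        case True
        have "(t - t * x) powr (b - 1) = t powr (b - 1) * (1 - x) powr (b - 1)"
          using powr_mult[of t "1 - x" "b - 1"] True t by (simp add: right_diff_distrib)
        moreover have "(t * x) ^ m = t powr real m * x powr real m"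
          using True t by (simp add: powr_realpow power_mult_distrib)
        ultimately show ?thesis
          using True t by (simp add: powr_add ennreal_mult'[symmetric] mult_ac)
      next
        case False
        then have "\<not> (0 \<le> x \<and> x \<le> 1)" "\<not> (0 \<le> t * x \<and> t * x \<le> t)"
          using elim t by (auto simp: zero_le_mult_iff mult_le_cancel_left1)
        then show ?thesis
          by simp
      qed
    qed
  qed
  also have "\<dots> = ennreal (t powr (b - 1 + real m)) * (\<integral>\<^sup>+ x. ennreal (?f x) * indicator {0..1} x \<partial>lborel)"
    by (rule nn_integral_cmult) measurable
  also have "(\<integral>\<^sup>+ x. ennreal (?f x) * indicator {0..1} x \<partial>lborel) = ennreal (Beta (real m + 1) b)"
    by (rule nn_integral_has_integral_lebesgue'[OF _ has_integral_Beta_real]) (use b in auto)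
  also have "ennreal t * (ennreal (t powr (b - 1 + real m)) * ennreal (Beta (real m + 1) b)) =
      ennreal (t powr (b + real m) * Beta (real m + 1) b)"
  proof -
    have "t powr (b + real m) = t * t powr (b - 1 + real m)"
      using t powr_add[of t 1 "b - 1 + real m"] by simp
    then show ?thesis
      using t by (simp add: ennreal_mult' mult.assoc)
  qed
  finally show ?thesis .
qed

text \<open>The beta function decreases in each argument, so its value at \<open>m = l = 0\<close>
  is an upper bound. The majorant is a product of a factor in \<open>m\<close> and a factor in
  \<open>l\<close>, which lets the two series be dominated one after the other.\<close>

lemma Beta_term_bounds:
  assumes t: "0 < t" and \<alpha>: "0 < \<alpha>"
  shows "0 \<le> t powr (\<alpha> + real l + real m) * Beta (real m + 1) (\<alpha> + real l)"
    and "t powr (\<alpha> + real l + real m) * Beta (real m + 1) (\<alpha> + real l) \<le>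
      t powr \<alpha> * Beta 1 \<alpha> * t ^ m * t ^ l"
proof -
  have "0 \<le> Beta (real m + 1) (\<alpha> + real l)"
    using \<alpha> by (simp add: Beta_def)
  then show "0 \<le> t powr (\<alpha> + real l + real m) * Beta (real m + 1) (\<alpha> + real l)"
    by simp
  have "Beta (real m + 1) (\<alpha> + real l) \<le> Beta 1 \<alpha>"
    using \<alpha> by (intro Beta_real_mono) auto
  then have "t powr (\<alpha> + real l + real m) * Beta (real m + 1) (\<alpha> + real l) \<le>
      t powr (\<alpha> + real l + real m) * Beta 1 \<alpha>"
    by (rule mult_left_mono) simp
  also have "\<dots> = t powr \<alpha> * Beta 1 \<alpha> * t ^ m * t ^ l"
    using t by (simp add: powr_add powr_realpow)
  finally show "t powr (\<alpha> + real l + real m) * Beta (real m + 1) (\<alpha> + real l) \<le>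
      t powr \<alpha> * Beta 1 \<alpha> * t ^ m * t ^ l" .
qed

section \<open>Generalized counting processes\<close>

context prob_space
begin

lemma emeasure_split_nat:
  fixes f :: "'a \<Rightarrow> nat"
  assumes [measurable]: "random_variable (count_space UNIV) f" "E \<in> events"
  shows "emeasure M E = (\<Sum>x. emeasure M {\<omega> \<in> E. f \<omega> = x})"
proof -
  have *: "{\<omega> \<in> E. f \<omega> = x} = E \<inter> {\<omega> \<in> space M. f \<omega> = x}" for x
    using sets.sets_into_space[OF assms(2)] by auto
  have "(\<Sum>x. emeasure M {\<omega> \<in> E. f \<omega> = x}) = emeasure M (\<Union>x. {\<omega> \<in> E. f \<omega> = x})"
    by (rule suminf_emeasure) (auto simp: disjoint_family_on_def *)
  also have "(\<Union>x. {\<omega> \<in> E. f \<omega> = x}) = E"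
    by auto
  finally show ?thesis ..
qed

text \<open>At each point, \<open>u ^ X\<close> is the sum over \<open>x\<close> of the indicator of
  \<open>X = x\<close> times \<open>u ^ x\<close>, with a single nonzero term. Sum and integral
  commute because the integrals of the absolute values are dominated by a geometric series.\<close>

lemma prob_generating_function_sums:
  fixes X :: "'a \<Rightarrow> nat"
  assumes [measurable]: "random_variable (count_space UNIV) X" and u: "\<bar>u\<bar> < 1"
  shows "(\<lambda>x. prob {\<omega> \<in> space M. X \<omega> = x} * u ^ x) sums expectation (\<lambda>\<omega>. u ^ X \<omega> :: real)"
proof -
  let ?f = "\<lambda>x \<omega>. indicator {\<omega> \<in> space M. X \<omega> = x} \<omega> * u ^ x :: real"
  have eq: "?f x \<omega> = (if x = X \<omega> then u ^ x else 0)" if "\<omega> \<in> space M" for x \<omega>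
    using that by (auto simp: indicator_def)
  have "(\<lambda>x. integral\<^sup>L M (?f x)) sums (\<integral>\<omega>. (\<Sum>x. ?f x \<omega>) \<partial>M)"
  proof (rule sums_integral)
    show "integrable M (?f x)" for x
      by (intro integrable_mult_left) (simp add: emeasure_eq_measure)
    show "AE \<omega> in M. summable (\<lambda>x. norm (?f x \<omega>))"
      by (rule AE_I2, rule summable_finite[of "{X \<omega>}" for \<omega>]) (auto simp: eq)
    have "(\<integral>\<omega>. norm (?f x \<omega>) \<partial>M) = prob {\<omega> \<in> space M. X \<omega> = x} * \<bar>u\<bar> ^ x" for x
      by (simp add: abs_mult power_abs)
    moreover have "summable (\<lambda>x. prob {\<omega> \<in> space M. X \<omega> = x} * \<bar>u\<bar> ^ x)"
      by (rule summable_comparison_test'[of "\<lambda>x. \<bar>u\<bar> ^ x" 0])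
        (use u in \<open>auto intro!: summable_geometric mult_left_le_one_le\<close>)
    ultimately show "summable (\<lambda>x. \<integral>\<omega>. norm (?f x \<omega>) \<partial>M)"
      by simp
  qed
  moreover have "(\<integral>\<omega>. (\<Sum>x. ?f x \<omega>) \<partial>M) = expectation (\<lambda>\<omega>. u ^ X \<omega>)"
  proof (rule Bochner_Integration.integral_cong)
    show "(\<Sum>x. ?f x \<omega>) = u ^ X \<omega>" if "\<omega> \<in> space M" for \<omega>
      using sums_single[of "X \<omega>" "\<lambda>x. u ^ x"] by (simp add: eq[OF that] sums_iff)
  qed simp
  ultimately show ?thesis
    by simp
qed

end

section \<open>Laws at one and two times, and joint measurability\<close>

context generalized_counting_process
begin

declare random_variable_at[measurable]

text \<open>The generating function is a constant exponential times the series of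
  \<open>Omega_series_sums\<close> for the rates \<open>s * rate j\<close>. Comparing coefficients
  with the series of probabilities gives the law.\<close>

lemma prob_at:
  assumes "0 \<le> s"
  shows "prob {\<omega> \<in> space P. M s \<omega> = x} =
    exp (- (\<Sum>j=1..k. rate j) * s) *
      (\<Sum>r\<in>Omega k x. (\<Prod>j=1..k. rate j ^ r j / fact (r j)) * s ^ (\<Sum>j=1..k. r j))"
proof -
  let ?F = "\<lambda>u. exp (- s * (\<Sum>j=1..k. rate j * (1 - u ^ j)))"
  let ?q = "\<lambda>x. \<Sum>r\<in>Omega k x. \<Prod>j=1..k. (s * rate j) ^ r j / fact (r j)"
  have [measurable]: "random_variable (count_space UNIV) (M s)"
    using assms by (rule random_variable_at)
  have "(\<lambda>x. prob {\<omega> \<in> space P. M s \<omega> = x}) = (\<lambda>x. exp (- (\<Sum>j=1..k. rate j) * s) * ?q x)"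
  proof (rule powser_unique_real[of 1 _ ?F])
    fix u :: real assume u: "\<bar>u\<bar> < 1"
    show "(\<lambda>x. prob {\<omega> \<in> space P. M s \<omega> = x} * u ^ x) sums ?F u"
      using prob_generating_function_sums[of "M s" u]
        probability_generating_function[of s u] u assms by simp
    have "(\<lambda>x. exp (- (\<Sum>j=1..k. rate j) * s) * (?q x * u ^ x)) sums
        (exp (- (\<Sum>j=1..k. rate j) * s) * exp (\<Sum>j=1..k. s * rate j * u ^ j))"
      by (intro sums_mult Omega_series_sums)
    also have "exp (- (\<Sum>j=1..k. rate j) * s) * exp (\<Sum>j=1..k. s * rate j * u ^ j) = ?F u"
      by (simp add: algebra_simps sum_subtractf sum_distrib_left sum_negf flip: exp_add)
    finally show "(\<lambda>x. exp (- (\<Sum>j=1..k. rate j) * s) * ?q x * u ^ x) sums ?F u"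
      by (simp add: mult.assoc)
  qed simp
  \<comment> \<open>Pulling the time out of the rates leaves a pure power of \<open>s\<close>, the
    form that the beta integrals require.\<close>
  moreover have "(\<Prod>j=1..k. (s * rate j) ^ r j / fact (r j)) =
      (\<Prod>j=1..k. rate j ^ r j / fact (r j)) * s ^ (\<Sum>j=1..k. r j)" for r
    by (simp add: power_mult_distrib power_sum mult.commute flip: prod.distrib)
  ultimately show ?thesis
    by (simp add: fun_eq_iff)
qed

text \<open>Since paths start at 0, \<open>M s\<close> is the increment over \<open>[0, s]\<close>,
  so independence and stationarity of the increments apply. The cases \<open>s = 0\<close> and
  \<open>d = 0\<close> are separate because independence is given for strictly increasing
  times.\<close>

lemma prob_two_times:
  assumes "0 \<le> s" "0 \<le> d"
  shows "prob {\<omega> \<in> space P. M s \<omega> = x \<and> int (M (s + d) \<omega>) - int (M s \<omega>) = y} =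
    prob {\<omega> \<in> space P. M s \<omega> = x} * prob {\<omega> \<in> space P. int (M d \<omega>) = y}"
proof -
  consider "s = 0" | "d = 0" | "0 < s" "0 < d"
    using assms by linarith
  then show ?thesis
  proof cases
    case 1
    then have "{\<omega> \<in> space P. M s \<omega> = x \<and> int (M (s + d) \<omega>) - int (M s \<omega>) = y} =
        (if x = 0 then {\<omega> \<in> space P. int (M d \<omega>) = y} else {})"
      and "{\<omega> \<in> space P. M s \<omega> = x} = (if x = 0 then space P else {})"
      by (auto simp: start_zero)
    then show ?thesis
      by (simp add: prob_space)
  next
    case 2
    then have "{\<omega> \<in> space P. M s \<omega> = x \<and> int (M (s + d) \<omega>) - int (M s \<omega>) = y} =
        (if y = 0 then {\<omega> \<in> space P. M s \<omega> = x} else {})"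
      and "{\<omega> \<in> space P. int (M d \<omega>) = y} = (if y = 0 then space P else {})"
      by (auto simp: start_zero)
    then show ?thesis
      by (simp add: prob_space)
  next
    case 3
    define \<tau> where "\<tau> i = (if i = 0 then 0 else if i = 1 then s else s + d)" for i :: nat
    let ?X = "\<lambda>i \<omega>. int (M (\<tau> (Suc i)) \<omega>) - int (M (\<tau> i) \<omega>)"
    define A where "A i = (if i = 0 then {int x} else {y})" for i :: nat
    have "indep_vars (\<lambda>_. count_space UNIV) ?X {..<2}"
      by (rule independent_increments) (use 3 in \<open>auto simp: \<tau>_def\<close>)
    then have "prob (\<Inter>i\<in>{..<2}. ?X i -` A i \<inter> space P) =
        (\<Prod>i\<in>{..<2}. prob (?X i -` A i \<inter> space P))"
      by (rule indep_varsD_finite) (auto simp: lessThan_empty_iff)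
    moreover have "{..<2::nat} = {0, 1}"
      by auto
    moreover have "?X 0 -` A 0 \<inter> space P = {\<omega> \<in> space P. M s \<omega> = x}"
      by (auto simp: \<tau>_def A_def start_zero)
    moreover have "?X 1 -` A 1 \<inter> space P =
        {\<omega> \<in> space P. int (M (s + d) \<omega>) - int (M s \<omega>) = y}"
      by (auto simp: \<tau>_def A_def)
    moreover have "{\<omega> \<in> space P. M s \<omega> = x} \<inter>
        {\<omega> \<in> space P. int (M (s + d) \<omega>) - int (M s \<omega>) = y} =
        {\<omega> \<in> space P. M s \<omega> = x \<and> int (M (s + d) \<omega>) - int (M s \<omega>) = y}"
      by auto
    ultimately have "prob {\<omega> \<in> space P. M s \<omega> = x \<and> int (M (s + d) \<omega>) - int (M s \<omega>) = y} =
        prob {\<omega> \<in> space P. M s \<omega> = x} *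
        prob {\<omega> \<in> space P. int (M (s + d) \<omega>) - int (M s \<omega>) = y}"
      by simp
    also have "prob {\<omega> \<in> space P. int (M (s + d) \<omega>) - int (M s \<omega>) = y} =
        prob {\<omega> \<in> space P. int (M d \<omega>) = y}"
    proof -
      have [measurable]: "M s \<in> measurable P (count_space UNIV)"
        "M d \<in> measurable P (count_space UNIV)" "M (s + d) \<in> measurable P (count_space UNIV)"
        using 3 by (auto intro: random_variable_at)
      have "measure (distr P (count_space UNIV) (\<lambda>\<omega>. int (M (s + d) \<omega>) - int (M s \<omega>))) {y} =
          measure (distr P (count_space UNIV) (\<lambda>\<omega>. int (M d \<omega>))) {y}"
        using stationary_increments[of s d] 3 by simp
      then show ?thesis
        by (simp add: measure_distr vimage_def Int_def conj_commute)
    qed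
    finally show ?thesis .
  qed
qed

lemma prob_pair:
  assumes "0 \<le> s" "0 \<le> d"
  shows "prob {\<omega> \<in> space P. M s \<omega> = x \<and> M (s + d) \<omega> = x + y} =
    prob {\<omega> \<in> space P. M s \<omega> = x} * prob {\<omega> \<in> space P. M d \<omega> = y}"
proof -
  have "{\<omega> \<in> space P. M s \<omega> = x \<and> int (M (s + d) \<omega>) - int (M s \<omega>) = int y} =
      {\<omega> \<in> space P. M s \<omega> = x \<and> M (s + d) \<omega> = x + y}"
    by auto
  then show ?thesis
    using prob_two_times[OF assms, of x "int y"] by simp
qed

text \<open>Monotone paths are not assumed: an increment has the law of a nonnegative variable.\<close>

lemma AE_mono:
  assumes "0 \<le> s" "s \<le> t"
  shows "AE \<omega> in P. M s \<omega> \<le> M t \<omega>"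
proof -
  have [measurable]: "M s \<in> measurable P (count_space UNIV)"
      "M t \<in> measurable P (count_space UNIV)" "M (t - s) \<in> measurable P (count_space UNIV)"
    using assms by (auto intro: random_variable_at)
  have "AE x in distr P (count_space UNIV) (\<lambda>\<omega>. int (M (t - s) \<omega>)). 0 \<le> x"
    by (simp add: AE_distr_iff)
  then have "AE x in distr P (count_space UNIV) (\<lambda>\<omega>. int (M t \<omega>) - int (M s \<omega>)). 0 \<le> x"
    using stationary_increments[of s "t - s"] assms
    by (metis add_diff_cancel_left' diff_ge_0_iff_ge le_add_diff_inverse)
  then show ?thesis
    by (simp add: AE_distr_iff)
qed

text \<open>Joint measurability comes from approximating the time from the right by multiples of
  \<open>1 / (i + 1)\<close>. Negative times are clamped, since nothing is known about the process there.\<close>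

lemma measurable_pair:
  "(\<lambda>(s, \<omega>). M (max 0 s) \<omega>) \<in> measurable (borel \<Otimes>\<^sub>M P) (count_space UNIV)"
proof -
  have "(\<lambda>p. real (M (max 0 (fst p)) (snd p))) \<in> borel_measurable (borel \<Otimes>\<^sub>M P)"
  proof (rule borel_measurable_LIMSEQ_real)
    \<comment> \<open>Adding 1 after the floor puts the approximating time strictly above
      \<open>max 0 s\<close>, as convergence along \<open>at_right\<close> demands, while the excess
      stays at most \<open>1 / real (Suc i)\<close>.\<close>
    let ?a = "\<lambda>i s. (real (nat \<lfloor>real (Suc i) * max 0 s\<rfloor>) + 1) / real (Suc i)"
    show "(\<lambda>i. real (M (?a i (fst p)) (snd p))) \<longlonglongrightarrow> real (M (max 0 (fst p)) (snd p))"
      if "p \<in> space (borel \<Otimes>\<^sub>M P)" for p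
    proof -
      define s where "s = max 0 (fst p)"
      have s: "0 \<le> s"
        by (simp add: s_def)
      have "((\<lambda>s. real (M s (snd p))) \<longlongrightarrow> real (M s (snd p))) (at_right s)"
        using right_continuous[of "snd p" s] that s
        by (simp add: continuous_within space_pair_measure mem_Times_iff)
      moreover have "filterlim (\<lambda>i. ?a i (fst p)) (at_right s) sequentially"
      proof (rule tendsto_imp_filterlim_at_right)
        have gt: "s < ?a i (fst p)" for i
          using s by (simp add: s_def[symmetric] field_simps) linarith
        have le: "?a i (fst p) \<le> s + 1 / real (Suc i)" for i
        proof -
          have "real (nat \<lfloor>real (Suc i) * s\<rfloor>) \<le> real (Suc i) * s"
            using s by simp
          then have "?a i (fst p) \<le> (real (Suc i) * s + 1) / real (Suc i)"
            unfolding s_def by (intro divide_right_mono) auto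
          then show ?thesis
            by (simp add: add_divide_distrib)
        qed
        show "(\<lambda>i. ?a i (fst p)) \<longlonglongrightarrow> s"
        proof (rule tendsto_sandwich[where f = "\<lambda>_. s"])
          show "(\<lambda>i. s + 1 / real (Suc i)) \<longlonglongrightarrow> s"
            using tendsto_add[OF tendsto_const LIMSEQ_inverse_real_of_nat, of s]
            by (simp add: field_simps)
        qed (use gt le in \<open>blast intro: always_eventually less_imp_le tendsto_const\<close>)+
        show "\<forall>\<^sub>F i in sequentially. s < ?a i (fst p)"
          using gt by (intro always_eventually) blast
      qed
      ultimately show ?thesis
        unfolding s_def by (rule filterlim_compose)
    qed
    \<comment> \<open>For fixed \<open>i\<close> the approximating time takes only countably many
      values, which reduces the claim to measurability at fixed times.\<close>
    show "(\<lambda>p. real (M (?a i (fst p)) (snd p))) \<in> borel_measurable (borel \<Otimes>\<^sub>M P)" for i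
    proof (rule measurable_compose_countable[where
          f = "\<lambda>n p. real (M ((real n + 1) / real (Suc i)) (snd p))"
          and g = "\<lambda>p. nat \<lfloor>real (Suc i) * max 0 (fst p)\<rfloor>"])
      show "(\<lambda>p. real (M ((real n + 1) / real (Suc i)) (snd p))) \<in> borel_measurable (borel \<Otimes>\<^sub>M P)" for n
        by measurable
    qed measurable
  qed
  then have "(\<lambda>p. nat \<lfloor>real (M (max 0 (fst p)) (snd p))\<rfloor>) \<in>
      measurable (borel \<Otimes>\<^sub>M P) (count_space UNIV)"
    by measurable
  then show ?thesis
    by (simp add: case_prod_unfold)
qed

end

section \<open>The iterated process\<close>

locale iterated_counting_process =
  outer: generalized_counting_process P k lam M +
  inner: generalized_counting_process P k0 \<mu> M0
  for P :: "'a measure" and k lam M k0 \<mu> M0 +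
  assumes indep: "independent_processes P M0 M"
begin

abbreviation "Mhat \<equiv> iterated_process M M0"

text \<open>Only natural times occur, since \<open>M\<close> is evaluated at values of
  \<open>M0\<close>. The value comes before the time so that \<open>outer_pmf r\<close> is a
  coefficient sequence for a series over \<open>x\<close>.\<close>

definition outer_pmf where "outer_pmf r x = measure P {\<omega> \<in> space P. M (real x) \<omega> = r}"

text \<open>The time-free part of the joint probability of independent Poisson counts with means
  \<open>\<mu> j * s\<close>: multiplying by \<open>exp (- \<mu>tot * s) * s ^ tot rs\<close>
  restores that probability.\<close>

definition weight where "weight rs = (\<Prod>j=1..k0. \<mu> j ^ rs j / fact (rs j))"

abbreviation tot where "tot rs \<equiv> (\<Sum>j=1..k0. rs j)"

abbreviation "\<mu>tot \<equiv> \<Sum>j=1..k0. \<mu> j"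

lemma outer_pmf_nonneg: "0 \<le> outer_pmf r x" and outer_pmf_le_1: "outer_pmf r x \<le> 1"
  by (simp_all add: outer_pmf_def)

lemma weight_nonneg: "0 \<le> weight rs"
  unfolding weight_def
  by (intro prod_nonneg) (auto intro!: divide_nonneg_pos zero_le_power less_imp_le[OF inner.rate_pos])

lemma inner_prob_at:
  "0 \<le> s \<Longrightarrow> measure P {\<omega> \<in> space P. M0 s \<omega> = x} =
    (\<Sum>rs\<in>Omega k0 x. weight rs * (exp (- \<mu>tot * s) * s ^ tot rs))"
  by (simp add: inner.prob_at weight_def sum_distrib_left mult_ac)

text \<open>Independence of the path-valued random elements is applied to two cylinder sets. Each
  fixes two coordinates, because the law of \<open>Mhat\<close> at two times involves two values of
  each process.\<close>

lemma prob_inner_outer: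
  assumes "0 \<le> s1" "0 \<le> s2" "0 \<le> u1" "0 \<le> u2"
  shows "measure P {\<omega> \<in> space P. (M0 s1 \<omega> = x1 \<and> M0 s2 \<omega> = x2) \<and> (M u1 \<omega> = r1 \<and> M u2 \<omega> = r2)} =
    measure P {\<omega> \<in> space P. M0 s1 \<omega> = x1 \<and> M0 s2 \<omega> = x2} *
    measure P {\<omega> \<in> space P. M u1 \<omega> = r1 \<and> M u2 \<omega> = r2}"
proof -
  let ?N = "\<Pi>\<^sub>M t\<in>{0 :: real..}. count_space (UNIV :: nat set)"
  let ?A = "{f \<in> space ?N. f s1 = x1 \<and> f s2 = x2}"
  let ?B = "{f \<in> space ?N. f u1 = r1 \<and> f u2 = r2}"
  have [measurable]: "(\<lambda>f. f i) \<in> measurable ?N (count_space UNIV)" if "0 \<le> i" for i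
    using that by (intro measurable_component_singleton) simp
  have AB: "?A \<in> sets ?N" "?B \<in> sets ?N"
    using assms by auto
  have space: "(\<lambda>t\<in>{0..}. X t) \<in> space ?N" for X
    by (simp add: space_PiM)
  have "outer.indep_var ?N (\<lambda>\<omega>. \<lambda>t\<in>{0..}. M0 t \<omega>) ?N (\<lambda>\<omega>. \<lambda>t\<in>{0..}. M t \<omega>)"
    using indep by (simp add: independent_processes_def)
  from outer.indep_varD[OF this AB] show ?thesis
    using assms space by (simp add: vimage_def Int_def conj_commute conj_left_commute)
qed

section \<open>Measurability and monotonicity of the iterated process\<close>

lemma random_variable_Mhat [measurable]:
  assumes "0 \<le> s"
  shows "Mhat s \<in> measurable P (count_space UNIV)"
proof -
  have "M0 s \<in> measurable P (count_space UNIV)"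
    using assms by (rule inner.random_variable_at)
  then show ?thesis
    unfolding iterated_process_def
    by (rule measurable_compose_countable[rotated]) (simp add: outer.random_variable_at)
qed

text \<open>The inner process is jointly measurable and takes countably many values, so
  \<open>M\<close> is needed only at fixed times. Joint measurability is what Tonelli's theorem and
  the measurability of the fractional integral rest on.\<close>

lemma measurable_Mhat_pair [measurable]:
  "(\<lambda>p. Mhat (max 0 (fst p)) (snd p)) \<in> measurable (borel \<Otimes>\<^sub>M P) (count_space UNIV)"
  unfolding iterated_process_def
proof (rule measurable_compose_countable[where f = "\<lambda>n p. M (real n) (snd p)"
      and g = "\<lambda>p. M0 (max 0 (fst p)) (snd p)"])
  show "(\<lambda>p. M (real n) (snd p)) \<in> measurable (borel \<Otimes>\<^sub>M P) (count_space UNIV)" for n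
    by (rule measurable_compose[OF measurable_snd]) (simp add: outer.random_variable_at)
  show "(\<lambda>p. M0 (max 0 (fst p)) (snd p)) \<in> measurable (borel \<Otimes>\<^sub>M P) (count_space UNIV)"
    using inner.measurable_pair by (simp add: case_prod_unfold)
qed

lemma measurable_Mhat_path:
  assumes "\<omega> \<in> space P"
  shows "(\<lambda>s. Mhat (max 0 s) \<omega>) \<in> measurable borel (count_space UNIV)"
  using measurable_compose[OF measurable_Pair2'[OF assms] measurable_Mhat_pair] by simp

text \<open>Monotonicity of \<open>M\<close> is wanted at random times, where an almost sure
  statement for each fixed pair of times is not enough. As \<open>M0\<close> takes natural values,
  countably many pairs suffice, and their exceptional null sets can be united.\<close>

lemma AE_Mhat_mono:
  assumes "0 \<le> s" "s \<le> t"
  shows "AE \<omega> in P. Mhat s \<omega> \<le> Mhat t \<omega>"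
proof -
  have "AE \<omega> in P. \<forall>x y :: nat. M (real x) \<omega> \<le> M (real (x + y)) \<omega>"
    by (intro AE_all_countable[THEN iffD2] allI outer.AE_mono) auto
  with inner.AE_mono[OF assms] show ?thesis
  proof eventually_elim
    case (elim \<omega>)
    then show ?case
      by (metis iterated_process_def le_add_diff_inverse)
  qed
qed

text \<open>The event is split by the value \<open>x\<close> of \<open>M0 s\<close> and the
  increment \<open>y\<close> up to time \<open>t\<close>. On such a cell, \<open>Mhat s\<close> and
  \<open>Mhat t\<close> are \<open>M\<close> at the times \<open>x\<close> and \<open>x + y\<close>,
  and independence of the processes and of their increments yields four factors.\<close>

lemma emeasure_joint:
  assumes "0 \<le> s" "s \<le> t" "r \<le> n"
  shows "emeasure P {\<omega> \<in> space P. Mhat s \<omega> = r \<and> Mhat t \<omega> = n} =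
    (\<Sum>x. \<Sum>y. ennreal (measure P {\<omega> \<in> space P. M0 s \<omega> = x} *
      measure P {\<omega> \<in> space P. M0 (t - s) \<omega> = y} * (outer_pmf r x * outer_pmf (n - r) y)))"
proof -
  let ?E = "{\<omega> \<in> space P. Mhat s \<omega> = r \<and> Mhat t \<omega> = n}"
  have t: "0 \<le> t"
    using assms by simp
  have [measurable]: "Mhat s \<in> measurable P (count_space UNIV)" "Mhat t \<in> measurable P (count_space UNIV)"
    "M0 s \<in> measurable P (count_space UNIV)" "M0 t \<in> measurable P (count_space UNIV)"
    using assms by (auto intro: random_variable_Mhat inner.random_variable_at)
  have [measurable]: "M (real x) \<in> measurable P (count_space UNIV)"
    "M (real x + real y) \<in> measurable P (count_space UNIV)" for x y
    by (auto intro: outer.random_variable_at)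
  have cell: "emeasure P {\<omega> \<in> {\<omega> \<in> ?E. M0 s \<omega> = x}. M0 t \<omega> - M0 s \<omega> = y} =
      ennreal (measure P {\<omega> \<in> space P. M0 s \<omega> = x} *
        measure P {\<omega> \<in> space P. M0 (t - s) \<omega> = y} * (outer_pmf r x * outer_pmf (n - r) y))" for x y
  proof -
    let ?F = "{\<omega> \<in> space P. (M0 s \<omega> = x \<and> M0 t \<omega> = x + y) \<and>
      (M (real x) \<omega> = r \<and> M (real x + real y) \<omega> = n)}"
    \<comment> \<open>The difference \<open>M0 t \<omega> - M0 s \<omega>\<close> is truncated, so
      for \<open>y = 0\<close> the two events agree only where
      \<open>M0 s \<omega> \<le> M0 t \<omega>\<close>, that is, almost surely.\<close>
    have "emeasure P {\<omega> \<in> {\<omega> \<in> ?E. M0 s \<omega> = x}. M0 t \<omega> - M0 s \<omega> = y} = emeasure P ?F"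
    proof (rule emeasure_eq_AE)
      show "AE \<omega> in P. \<omega> \<in> {\<omega> \<in> {\<omega> \<in> ?E. M0 s \<omega> = x}. M0 t \<omega> - M0 s \<omega> = y} \<longleftrightarrow> \<omega> \<in> ?F"
        using inner.AE_mono[OF assms(1,2)]
      proof eventually_elim
        case (elim \<omega>)
        then show ?case
          by (auto simp: iterated_process_def of_nat_add[symmetric] simp del: of_nat_add)
      qed
    qed measurable
    also have "\<dots> = ennreal (measure P ?F)"
      by (rule outer.emeasure_eq_measure)
    also have "measure P ?F = measure P {\<omega> \<in> space P. M0 s \<omega> = x} *
        measure P {\<omega> \<in> space P. M0 (t - s) \<omega> = y} * (outer_pmf r x * outer_pmf (n - r) y)"
      using inner.prob_pair[of s "t - s" x y] outer.prob_pair[of "real x" "real y" r "n - r"] assms t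
        prob_inner_outer[of s t "real x" "real x + real y" x "x + y" r n]
      by (simp add: outer_pmf_def)
    finally show ?thesis .
  qed
  have "emeasure P ?E = (\<Sum>x. emeasure P {\<omega> \<in> ?E. M0 s \<omega> = x})"
    by (rule outer.emeasure_split_nat) measurable
  also have "\<dots> = (\<Sum>x. \<Sum>y. emeasure P {\<omega> \<in> {\<omega> \<in> ?E. M0 s \<omega> = x}. M0 t \<omega> - M0 s \<omega> = y})"
    by (rule suminf_cong, rule outer.emeasure_split_nat) measurable
  finally show ?thesis
    by (simp only: cell)
qed

text \<open>The shape shared by the integrand at a fixed time and by the final formula; only
  \<open>\<phi>\<close> changes between them. The nesting is that of the claimed series, and values
  in \<open>ennreal\<close> make every interchange of sums and integrals unconditional.\<close>

definition weighted_series :: "(nat \<Rightarrow> real) \<Rightarrow> (nat \<Rightarrow> real) \<Rightarrow>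
    ((nat \<Rightarrow> nat) \<Rightarrow> (nat \<Rightarrow> nat) \<Rightarrow> ennreal) \<Rightarrow> ennreal" where
  "weighted_series a b \<phi> = (\<Sum>x. ennreal (a x) * (\<Sum>rs\<in>Omega k0 x. ennreal (weight rs) *
    (\<Sum>y. ennreal (b y) * (\<Sum>ls\<in>Omega k0 y. ennreal (weight ls) * \<phi> rs ls))))"

text \<open>Monotone convergence handles both infinite series; the finite sums and constant factors
  pass through the integral by linearity.\<close>

lemma nn_integral_weighted_series:
  assumes [measurable]: "\<And>rs ls. (\<lambda>s. \<phi> s rs ls) \<in> borel_measurable N"
  shows "(\<integral>\<^sup>+ s. weighted_series a b (\<phi> s) \<partial>N) = weighted_series a b (\<lambda>rs ls. \<integral>\<^sup>+ s. \<phi> s rs ls \<partial>N)"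
  unfolding weighted_series_def by (simp add: nn_integral_suminf nn_integral_cmult nn_integral_sum)

lemma weighted_series_cmult: "weighted_series a b (\<lambda>rs ls. c * \<phi> rs ls) = c * weighted_series a b \<phi>"
  unfolding weighted_series_def by (simp add: mult.left_commute[of _ c] flip: sum_distrib_left)

text \<open>A real \<open>suminf\<close> agrees with the one in \<open>ennreal\<close> only for
  convergent series. As \<open>a\<close> and \<open>b\<close> are bounded by 1, the product bound on
  \<open>T\<close> dominates first the inner series (\<open>G\<close>) and then the outer one
  (\<open>H\<close>) by multiples of one convergent series.\<close>

lemma
  assumes a: "\<And>x. 0 \<le> a x" "\<And>x. a x \<le> 1" and b: "\<And>y. 0 \<le> b y" "\<And>y. b y \<le> 1"
    and T: "\<And>rs ls. 0 \<le> T rs ls" "\<And>rs ls. T rs ls \<le> C * t ^ tot rs * t ^ tot ls"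
  shows weighted_series_ennreal: "weighted_series a b (\<lambda>rs ls. ennreal (T rs ls)) =
      ennreal (\<Sum>x. a x * (\<Sum>rs\<in>Omega k0 x. weight rs *
        (\<Sum>y. b y * (\<Sum>ls\<in>Omega k0 y. weight ls * T rs ls))))"
    and weighted_series_nonneg: "0 \<le> (\<Sum>x. a x * (\<Sum>rs\<in>Omega k0 x. weight rs *
        (\<Sum>y. b y * (\<Sum>ls\<in>Omega k0 y. weight ls * T rs ls))))"
proof -
  \<comment> \<open>This is the series of \<open>exp (\<mu>tot * t)\<close>, grouped by
    degree.\<close>
  define S where "S x = (\<Sum>rs\<in>Omega k0 x. weight rs * t ^ tot rs)" for x
  have S: "summable S"
    unfolding S_def weight_def by (rule Omega_weight_summable)
  define G where "G rs y = b y * (\<Sum>ls\<in>Omega k0 y. weight ls * T rs ls)" for rs y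
  have G_nonneg: "0 \<le> G rs y" for rs y
    unfolding G_def by (intro mult_nonneg_nonneg sum_nonneg b T weight_nonneg)
  have G_le: "G rs y \<le> C * t ^ tot rs * S y" for rs y
  proof -
    have "G rs y \<le> (\<Sum>ls\<in>Omega k0 y. weight ls * T rs ls)"
      unfolding G_def by (intro mult_left_le_one_le sum_nonneg mult_nonneg_nonneg b T weight_nonneg)
    also have "\<dots> \<le> (\<Sum>ls\<in>Omega k0 y. weight ls * (C * t ^ tot rs * t ^ tot ls))"
      by (intro sum_mono mult_left_mono T weight_nonneg)
    finally show ?thesis
      by (simp add: S_def sum_distrib_left mult_ac)
  qed
  have G_summable: "summable (G rs)" for rs
    by (rule summable_comparison_test'[OF summable_mult[OF S], where N = 0])
      (simp only: real_norm_def abs_of_nonneg[OF G_nonneg], rule G_le)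
  have sumG: "0 \<le> suminf (G rs)" "suminf (G rs) \<le> C * t ^ tot rs * suminf S" for rs
    using suminf_le[OF G_le G_summable summable_mult[OF S]] suminf_nonneg[OF G_summable G_nonneg]
    by (simp_all only: suminf_mult[OF S])
  define H where "H x = a x * (\<Sum>rs\<in>Omega k0 x. weight rs * suminf (G rs))" for x
  have H_nonneg: "0 \<le> H x" for x
    unfolding H_def by (intro mult_nonneg_nonneg sum_nonneg a sumG weight_nonneg)
  have H_le: "H x \<le> C * suminf S * S x" for x
  proof -
    have "H x \<le> (\<Sum>rs\<in>Omega k0 x. weight rs * suminf (G rs))"
      unfolding H_def by (intro mult_left_le_one_le sum_nonneg mult_nonneg_nonneg a sumG weight_nonneg)
    also have "\<dots> \<le> (\<Sum>rs\<in>Omega k0 x. weight rs * (C * t ^ tot rs * suminf S))"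
      by (intro sum_mono mult_left_mono sumG weight_nonneg)
    finally show ?thesis
      by (simp add: S_def sum_distrib_left mult_ac)
  qed
  have H_summable: "summable H"
    by (rule summable_comparison_test'[OF summable_mult[OF S], where N = 0])
      (simp only: real_norm_def abs_of_nonneg[OF H_nonneg], rule H_le)
  have "ennreal (b y) * (\<Sum>ls\<in>Omega k0 y. ennreal (weight ls) * ennreal (T rs ls)) =
      ennreal (G rs y)" for rs y
    unfolding G_def by (simp add: b T weight_nonneg sum_nonneg ennreal_mult'[symmetric])
  moreover have "ennreal (a x) * (\<Sum>rs\<in>Omega k0 x. ennreal (weight rs) * ennreal (suminf (G rs))) =
      ennreal (H x)" for x
    unfolding H_def by (simp add: a sumG weight_nonneg sum_nonneg ennreal_mult'[symmetric])
  ultimately have "weighted_series a b (\<lambda>rs ls. ennreal (T rs ls)) = (\<Sum>x. ennreal (H x))"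
    by (simp only: weighted_series_def suminf_ennreal2[OF G_nonneg G_summable])
  also have "\<dots> = ennreal (suminf H)"
    by (rule suminf_ennreal2[OF H_nonneg H_summable])
  finally show "weighted_series a b (\<lambda>rs ls. ennreal (T rs ls)) =
      ennreal (\<Sum>x. a x * (\<Sum>rs\<in>Omega k0 x. weight rs *
        (\<Sum>y. b y * (\<Sum>ls\<in>Omega k0 y. weight ls * T rs ls))))"
    unfolding H_def G_def .
  show "0 \<le> (\<Sum>x. a x * (\<Sum>rs\<in>Omega k0 x. weight rs *
      (\<Sum>y. b y * (\<Sum>ls\<in>Omega k0 y. weight ls * T rs ls))))"
    using suminf_nonneg[OF H_summable H_nonneg] unfolding H_def G_def .
qed

text \<open>The exponentials from \<open>[0, s]\<close> and \<open>[s, t]\<close> multiply to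
  \<open>exp (- \<mu>tot * t)\<close>, and the power of \<open>t - s\<close> from the increment
  merges with the fractional kernel. What remains of \<open>s\<close> is exactly a beta
  integrand.\<close>

lemma kernel_times_emeasure_joint:
  assumes "0 \<le> s" "s \<le> t" "r \<le> n"
  shows "ennreal ((t - s) powr (\<alpha> - 1)) * emeasure P {\<omega> \<in> space P. Mhat s \<omega> = r \<and> Mhat t \<omega> = n} =
    weighted_series (outer_pmf r) (outer_pmf (n - r)) (\<lambda>rs ls. ennreal (exp (- \<mu>tot * t)) *
      ennreal (s ^ tot rs * (t - s) powr (\<alpha> + real (tot ls) - 1)))"
proof -
  let ?w = "(t - s) powr (\<alpha> - 1)"
  let ?G = "\<lambda>rs ls. ennreal (weight ls) * (ennreal (exp (- \<mu>tot * t)) *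
      ennreal (s ^ tot rs * (t - s) powr (\<alpha> + real (tot ls) - 1)))"
  have G: "ennreal (weight rs * (exp (- \<mu>tot * s) * s ^ tot rs)) *
      ennreal (?w * (weight ls * (exp (- \<mu>tot * (t - s)) * (t - s) ^ tot ls))) =
      ennreal (weight rs) * ?G rs ls" for rs ls
  proof -
    have \<alpha>_eq: "\<alpha> + real (tot ls) - 1 = (\<alpha> - 1) + real (tot ls)"
      by simp
    \<comment> \<open>At \<open>s = t\<close> both sides vanish, since \<open>0 powr c = 0\<close>
      for every \<open>c\<close>; the law relating \<open>powr\<close> to natural powers covers only
      a positive base.\<close>
    have "(t - s) powr (\<alpha> + real (tot ls) - 1) = ?w * (t - s) ^ tot ls"
    proof (cases "s = t")
      case False
      then show ?thesis
        using assms powr_realpow[of "t - s" "tot ls"]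
        unfolding \<alpha>_eq powr_add by simp
    qed simp
    moreover have "exp (- \<mu>tot * t) = exp (- \<mu>tot * s) * exp (- \<mu>tot * (t - s))"
      by (simp add: algebra_simps flip: exp_add)
    ultimately show ?thesis
      using assms weight_nonneg[of rs] weight_nonneg[of ls]
      by (simp add: ennreal_mult'[symmetric] mult_ac)
  qed
  have "ennreal ?w * emeasure P {\<omega> \<in> space P. Mhat s \<omega> = r \<and> Mhat t \<omega> = n} =
      (\<Sum>x. \<Sum>y. ennreal ?w * ennreal (measure P {\<omega> \<in> space P. M0 s \<omega> = x} *
        measure P {\<omega> \<in> space P. M0 (t - s) \<omega> = y} * (outer_pmf r x * outer_pmf (n - r) y)))"
    by (simp add: emeasure_joint assms)
  also have "\<dots> = (\<Sum>x. \<Sum>y. ennreal (outer_pmf r x) * (ennreal (outer_pmf (n - r) y) *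
      (\<Sum>rs\<in>Omega k0 x. \<Sum>ls\<in>Omega k0 y. ennreal (weight rs) * ?G rs ls)))"
  proof (intro suminf_cong)
    fix x y
    let ?a = "measure P {\<omega> \<in> space P. M0 s \<omega> = x}"
    let ?b = "measure P {\<omega> \<in> space P. M0 (t - s) \<omega> = y}"
    have "ennreal ?w * ennreal (?a * ?b * (outer_pmf r x * outer_pmf (n - r) y)) =
        ennreal (outer_pmf r x) * (ennreal (outer_pmf (n - r) y) * (ennreal ?a * ennreal (?w * ?b)))"
      by (simp add: ennreal_mult'[symmetric] outer_pmf_nonneg mult_ac)
    also have "ennreal ?a = (\<Sum>rs\<in>Omega k0 x. ennreal (weight rs * (exp (- \<mu>tot * s) * s ^ tot rs)))"
      using assms by (subst inner_prob_at) (auto intro!: sum_ennreal[symmetric] mult_nonneg_nonneg weight_nonneg)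
    also have "ennreal (?w * ?b) = (\<Sum>ls\<in>Omega k0 y.
        ennreal (?w * (weight ls * (exp (- \<mu>tot * (t - s)) * (t - s) ^ tot ls))))"
      using assms by (subst inner_prob_at, simp, subst sum_distrib_left)
        (auto intro!: sum_ennreal[symmetric] mult_nonneg_nonneg weight_nonneg)
    finally show "ennreal ?w * ennreal (?a * ?b * (outer_pmf r x * outer_pmf (n - r) y)) =
        ennreal (outer_pmf r x) * (ennreal (outer_pmf (n - r) y) *
          (\<Sum>rs\<in>Omega k0 x. \<Sum>ls\<in>Omega k0 y. ennreal (weight rs) * ?G rs ls))"
      by (simp only: sum_product G)
  qed
  \<comment> \<open>The finite sum over \<open>rs\<close> is moved outside the series over
    \<open>y\<close> to reach the nesting of \<open>weighted_series\<close>.\<close>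
  also have "\<dots> = (\<Sum>x. ennreal (outer_pmf r x) * (\<Sum>rs\<in>Omega k0 x. ennreal (weight rs) *
      (\<Sum>y. ennreal (outer_pmf (n - r) y) * (\<Sum>ls\<in>Omega k0 y. ?G rs ls))))"
  proof (intro suminf_cong)
    fix x
    have "(\<Sum>y. ennreal (outer_pmf r x) * (ennreal (outer_pmf (n - r) y) *
        (\<Sum>rs\<in>Omega k0 x. \<Sum>ls\<in>Omega k0 y. ennreal (weight rs) * ?G rs ls))) =
        (\<Sum>y. \<Sum>rs\<in>Omega k0 x. ennreal (outer_pmf r x) * (ennreal (weight rs) *
          (ennreal (outer_pmf (n - r) y) * (\<Sum>ls\<in>Omega k0 y. ?G rs ls))))"
      by (simp only: sum_distrib_left mult_ac)
    also have "\<dots> = (\<Sum>rs\<in>Omega k0 x. \<Sum>y. ennreal (outer_pmf r x) * (ennreal (weight rs) *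
          (ennreal (outer_pmf (n - r) y) * (\<Sum>ls\<in>Omega k0 y. ?G rs ls))))"
      by (intro suminf_sum summableI)
    also have "\<dots> = ennreal (outer_pmf r x) * (\<Sum>rs\<in>Omega k0 x. ennreal (weight rs) *
        (\<Sum>y. ennreal (outer_pmf (n - r) y) * (\<Sum>ls\<in>Omega k0 y. ?G rs ls)))"
      by (simp only: ennreal_suminf_cmult sum_distrib_left[symmetric])
    finally show "(\<Sum>y. ennreal (outer_pmf r x) * (ennreal (outer_pmf (n - r) y) *
        (\<Sum>rs\<in>Omega k0 x. \<Sum>ls\<in>Omega k0 y. ennreal (weight rs) * ?G rs ls))) =
        ennreal (outer_pmf r x) * (\<Sum>rs\<in>Omega k0 x. ennreal (weight rs) *
        (\<Sum>y. ennreal (outer_pmf (n - r) y) * (\<Sum>ls\<in>Omega k0 y. ?G rs ls)))" .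
  qed
  finally show ?thesis
    unfolding weighted_series_def .
qed

text \<open>Almost sure monotonicity gives \<open>Mhat s \<le> n\<close> on the event
  \<open>Mhat t = n\<close>, which is why the sum stops at \<open>n\<close>.\<close>

lemma nn_integral_Mhat_on_event:
  assumes "0 \<le> s" "s \<le> t"
  shows "(\<integral>\<^sup>+ \<omega>. ennreal (real (Mhat s \<omega>)) * indicator {\<omega> \<in> space P. Mhat t \<omega> = n} \<omega> \<partial>P) =
    (\<Sum>r=0..n. ennreal (real r) * emeasure P {\<omega> \<in> space P. Mhat s \<omega> = r \<and> Mhat t \<omega> = n})"
proof -
  have [measurable]: "Mhat s \<in> measurable P (count_space UNIV)" "Mhat t \<in> measurable P (count_space UNIV)"
    using assms by (auto intro: random_variable_Mhat)
  have "(\<integral>\<^sup>+ \<omega>. ennreal (real (Mhat s \<omega>)) * indicator {\<omega> \<in> space P. Mhat t \<omega> = n} \<omega> \<partial>P) =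
      (\<integral>\<^sup>+ \<omega>. (\<Sum>r=0..n. ennreal (real r) *
        indicator {\<omega> \<in> space P. Mhat s \<omega> = r \<and> Mhat t \<omega> = n} \<omega>) \<partial>P)"
  proof (rule nn_integral_cong_AE)
    show "AE \<omega> in P. ennreal (real (Mhat s \<omega>)) * indicator {\<omega> \<in> space P. Mhat t \<omega> = n} \<omega> =
        (\<Sum>r=0..n. ennreal (real r) * indicator {\<omega> \<in> space P. Mhat s \<omega> = r \<and> Mhat t \<omega> = n} \<omega>)"
      using AE_Mhat_mono[OF assms] AE_space
    proof eventually_elim
      case (elim \<omega>)
      have "(\<Sum>r=0..n. ennreal (real r) *
            indicator {\<omega> \<in> space P. Mhat s \<omega> = r \<and> Mhat t \<omega> = n} \<omega>) =
          (\<Sum>r=0..n. if r = Mhat s \<omega> then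
            ennreal (real r) * indicator {\<omega> \<in> space P. Mhat t \<omega> = n} \<omega> else 0)"
        using elim by (intro sum.cong) (auto simp: indicator_def)
      also have "\<dots> = ennreal (real (Mhat s \<omega>)) * indicator {\<omega> \<in> space P. Mhat t \<omega> = n} \<omega>"
        using elim by (auto simp: indicator_def)
      finally show ?case ..
    qed
  qed
  also have "\<dots> = (\<Sum>r=0..n. \<integral>\<^sup>+ \<omega>. ennreal (real r) *
      indicator {\<omega> \<in> space P. Mhat s \<omega> = r \<and> Mhat t \<omega> = n} \<omega> \<partial>P)"
    by (rule nn_integral_sum) measurable
  also have "\<dots> = (\<Sum>r=0..n. ennreal (real r) *
      emeasure P {\<omega> \<in> space P. Mhat s \<omega> = r \<and> Mhat t \<omega> = n})"
    by (intro sum.cong nn_integral_cmult_indicator refl) measurable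
  finally show ?thesis .
qed

text \<open>Tonelli's theorem moves the expectation inside the time integral, where the joint law
  turns the integrand into weighted series; integrating these term by term leaves scaled beta
  integrals. Clamping by \<open>max 0 s\<close> changes nothing on \<open>[0, t]\<close>.\<close>

lemma nn_integral_fractional_on_event:
  assumes t: "0 < t" and \<alpha>: "0 < \<alpha>"
  shows "(\<integral>\<^sup>+ \<omega>. (\<integral>\<^sup>+ s. ennreal ((t - s) powr (\<alpha> - 1)) * ennreal (real (Mhat (max 0 s) \<omega>)) *
      indicator {0..t} s \<partial>lborel) * indicator {\<omega> \<in> space P. Mhat t \<omega> = n} \<omega> \<partial>P) =
    (\<Sum>r=0..n. ennreal (real r) * (ennreal (exp (- \<mu>tot * t)) *
      weighted_series (outer_pmf r) (outer_pmf (n - r)) (\<lambda>rs ls. ennreal (t powr (\<alpha> + real (tot ls) + real (tot rs)) *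
        Beta (real (tot rs) + 1) (\<alpha> + real (tot ls))))))" (is "?lhs = _")
proof -
  let ?A = "{\<omega> \<in> space P. Mhat t \<omega> = n}"
  let ?\<phi> = "\<lambda>s rs ls. ennreal (exp (- \<mu>tot * t)) *
      (ennreal (s ^ tot rs * (t - s) powr (\<alpha> + real (tot ls) - 1)) * indicator {0..t} s)"
  have [measurable]: "Mhat t \<in> measurable P (count_space UNIV)"
    using t by (intro random_variable_Mhat) simp
  interpret pair_sigma_finite lborel P
    by (intro pair_sigma_finite.intro lborel.sigma_finite_measure_axioms
        outer.sigma_finite_measure_axioms)
  have Beta: "(\<integral>\<^sup>+ s. ?\<phi> s rs ls \<partial>lborel) = ennreal (exp (- \<mu>tot * t)) *
      ennreal (t powr (\<alpha> + real (tot ls) + real (tot rs)) *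
        Beta (real (tot rs) + 1) (\<alpha> + real (tot ls)))" for rs ls
    using nn_integral_Beta_scaled[of "\<alpha> + real (tot ls)" t "tot rs"] \<alpha> t
    by (simp add: nn_integral_cmult del: of_nat_sum)
  have "?lhs = (\<integral>\<^sup>+ \<omega>. (\<integral>\<^sup>+ s. ennreal ((t - s) powr (\<alpha> - 1)) * indicator {0..t} s *
      (ennreal (real (Mhat (max 0 s) \<omega>)) * indicator ?A \<omega>) \<partial>lborel) \<partial>P)"
  proof (rule nn_integral_cong)
    fix \<omega> assume "\<omega> \<in> space P"
    note [measurable] = measurable_Mhat_path[OF this]
    show "(\<integral>\<^sup>+ s. ennreal ((t - s) powr (\<alpha> - 1)) * ennreal (real (Mhat (max 0 s) \<omega>)) *
        indicator {0..t} s \<partial>lborel) * indicator ?A \<omega> =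
        (\<integral>\<^sup>+ s. ennreal ((t - s) powr (\<alpha> - 1)) * indicator {0..t} s *
          (ennreal (real (Mhat (max 0 s) \<omega>)) * indicator ?A \<omega>) \<partial>lborel)"
      by (subst nn_integral_multc[symmetric]) (measurable, simp only: mult_ac)
  qed
  also have "\<dots> = (\<integral>\<^sup>+ s. (\<integral>\<^sup>+ \<omega>. ennreal ((t - s) powr (\<alpha> - 1)) * indicator {0..t} s *
      (ennreal (real (Mhat (max 0 s) \<omega>)) * indicator ?A \<omega>) \<partial>P) \<partial>lborel)"
    by (rule Fubini') measurable
  also have "\<dots> = (\<integral>\<^sup>+ s. (\<Sum>r=0..n. ennreal (real r) * weighted_series (outer_pmf r) (outer_pmf (n - r)) (?\<phi> s)) \<partial>lborel)"
  proof (rule nn_integral_cong)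
    fix s :: real
    have [measurable]: "Mhat (max 0 s) \<in> measurable P (count_space UNIV)"
      by (rule random_variable_Mhat) simp
    have "(\<integral>\<^sup>+ \<omega>. ennreal ((t - s) powr (\<alpha> - 1)) * indicator {0..t} s *
        (ennreal (real (Mhat (max 0 s) \<omega>)) * indicator ?A \<omega>) \<partial>P) =
        ennreal ((t - s) powr (\<alpha> - 1)) * indicator {0..t} s *
        (\<integral>\<^sup>+ \<omega>. ennreal (real (Mhat (max 0 s) \<omega>)) * indicator ?A \<omega> \<partial>P)"
      by (rule nn_integral_cmult) measurable
    also have "\<dots> = (\<Sum>r=0..n. ennreal (real r) * weighted_series (outer_pmf r) (outer_pmf (n - r)) (?\<phi> s))"
    proof (cases "s \<in> {0..t}")
      case True
      then show ?thesis
        by (simp add: nn_integral_Mhat_on_event sum_distrib_left mult.left_commute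
            kernel_times_emeasure_joint)
    next
      \<comment> \<open>Outside \<open>[0, t]\<close> the indicator annihilates both the kernel and
        every term of the series.\<close>
      case False
      then show ?thesis
        by (simp add: weighted_series_def)
    qed
    finally show "(\<integral>\<^sup>+ \<omega>. ennreal ((t - s) powr (\<alpha> - 1)) * indicator {0..t} s *
        (ennreal (real (Mhat (max 0 s) \<omega>)) * indicator ?A \<omega>) \<partial>P) =
        (\<Sum>r=0..n. ennreal (real r) * weighted_series (outer_pmf r) (outer_pmf (n - r)) (?\<phi> s))" .
  qed
  also have "\<dots> = (\<Sum>r=0..n. ennreal (real r) *
      weighted_series (outer_pmf r) (outer_pmf (n - r)) (\<lambda>rs ls. \<integral>\<^sup>+ s. ?\<phi> s rs ls \<partial>lborel))"
  proof -
    have [measurable]: "(\<lambda>s. weighted_series a b (?\<phi> s)) \<in> borel_measurable lborel" for a b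
      unfolding weighted_series_def by measurable
    have inner: "(\<integral>\<^sup>+ s. weighted_series a b (?\<phi> s) \<partial>lborel) =
        weighted_series a b (\<lambda>rs ls. \<integral>\<^sup>+ s. ?\<phi> s rs ls \<partial>lborel)" for a b
      by (rule nn_integral_weighted_series) measurable
    have "(\<integral>\<^sup>+ s. (\<Sum>r=0..n. ennreal (real r) * weighted_series (outer_pmf r) (outer_pmf (n - r)) (?\<phi> s)) \<partial>lborel) =
        (\<Sum>r=0..n. \<integral>\<^sup>+ s. ennreal (real r) * weighted_series (outer_pmf r) (outer_pmf (n - r)) (?\<phi> s) \<partial>lborel)"
      by (rule nn_integral_sum) measurable
    also have "\<dots> = (\<Sum>r=0..n. ennreal (real r) * (\<integral>\<^sup>+ s. weighted_series (outer_pmf r) (outer_pmf (n - r)) (?\<phi> s) \<partial>lborel))"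
      by (intro sum.cong nn_integral_cmult refl) measurable
    finally show ?thesis
      by (simp only: inner)
  qed
  finally show ?thesis
    by (simp only: Beta weighted_series_cmult)
qed

section \<open>Conditional expectation of the fractional integral\<close>

lemma expectation_fractional_given_event:
  assumes t: "0 < t" and \<alpha>: "0 < \<alpha>"
  shows "expectation_given_event P
      (\<lambda>\<omega>. riemann_liouville_integral \<alpha> (\<lambda>s. real (Mhat s \<omega>)) t) {\<omega> \<in> space P. Mhat t \<omega> = n} =
    1 / Gamma \<alpha> * (\<Sum>r=0..n. real r * exp (- \<mu>tot * t) / measure P {\<omega> \<in> space P. Mhat t \<omega> = n} *
      (\<Sum>x. outer_pmf r x * (\<Sum>rs\<in>Omega k0 x. weight rs *
        (\<Sum>y. outer_pmf (n - r) y * (\<Sum>ls\<in>Omega k0 y. weight ls *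
          (t powr (\<alpha> + real (tot ls) + real (tot rs)) *
           Beta (real (tot rs) + 1) (\<alpha> + real (tot ls))))))))"
    (is "_ = 1 / Gamma \<alpha> * (\<Sum>r=0..n. real r * ?e / ?pA * ?Q r)")
proof -
  let ?A = "{\<omega> \<in> space P. Mhat t \<omega> = n}"
  let ?T = "\<lambda>rs ls. t powr (\<alpha> + real (tot ls) + real (tot rs)) *
      Beta (real (tot rs) + 1) (\<alpha> + real (tot ls))"
  \<comment> \<open>The fractional integral without the factor \<open>1 / Gamma \<alpha>\<close>, as
    a nonnegative integral that may be infinite.\<close>
  define Y where "Y \<omega> = (\<integral>\<^sup>+ s. ennreal ((t - s) powr (\<alpha> - 1)) * ennreal (real (Mhat (max 0 s) \<omega>)) *
      indicator {0..t} s \<partial>lborel)" for \<omega>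
  define X where "X \<omega> = riemann_liouville_integral \<alpha> (\<lambda>s. real (Mhat s \<omega>)) t" for \<omega>
  have [measurable]: "Mhat t \<in> measurable P (count_space UNIV)"
    using t by (intro random_variable_Mhat) simp
  have Y_meas [measurable]: "Y \<in> borel_measurable P"
    unfolding Y_def
  proof (rule lborel.borel_measurable_nn_integral)
    have "(\<lambda>q. Mhat (max 0 (snd q)) (fst q)) \<in> measurable (P \<Otimes>\<^sub>M lborel) (count_space UNIV)"
      using measurable_compose[OF measurable_pair_swap' measurable_Mhat_pair]
      by (simp add: case_prod_unfold cong: measurable_cong_sets)
    then show "(\<lambda>(\<omega>, s). ennreal ((t - s) powr (\<alpha> - 1)) * ennreal (real (Mhat (max 0 s) \<omega>)) *
        indicator {0..t} s) \<in> borel_measurable (P \<Otimes>\<^sub>M lborel)"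
      unfolding case_prod_unfold by measurable
  qed
  \<comment> \<open>This holds on every path: if the kernel integral diverges, the Bochner integral
    and \<open>enn2real \<infinity>\<close> are both 0.\<close>
  have X_eq: "X \<omega> = 1 / Gamma \<alpha> * enn2real (Y \<omega>)" if "\<omega> \<in> space P" for \<omega>
  proof -
    have path [measurable]: "(\<lambda>s. Mhat (max 0 s) \<omega>) \<in> measurable borel (count_space UNIV)"
      using that by (rule measurable_Mhat_path)
    have "(LBINT s:{0..t}. (t - s) powr (\<alpha> - 1) * real (Mhat s \<omega>)) =
        (\<integral>s. (t - s) powr (\<alpha> - 1) * real (Mhat (max 0 s) \<omega>) * indicator {0..t} s \<partial>lborel)"
      unfolding set_lebesgue_integral_def
      by (intro Bochner_Integration.integral_cong) (auto simp: indicator_def)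
    also have "\<dots> = enn2real (\<integral>\<^sup>+ s. ennreal ((t - s) powr (\<alpha> - 1) * real (Mhat (max 0 s) \<omega>) *
        indicator {0..t} s) \<partial>lborel)"
      by (rule integral_eq_nn_integral) auto
    also have "(\<integral>\<^sup>+ s. ennreal ((t - s) powr (\<alpha> - 1) * real (Mhat (max 0 s) \<omega>) *
        indicator {0..t} s) \<partial>lborel) = Y \<omega>"
      unfolding Y_def by (intro nn_integral_cong) (auto simp: indicator_def ennreal_mult)
    finally show ?thesis
      by (simp add: X_def riemann_liouville_integral_def)
  qed
  have X_meas [measurable]: "X \<in> borel_measurable P"
    by (subst measurable_cong[OF X_eq]) measurable
  have X_nonneg: "0 \<le> X \<omega>" if "\<omega> \<in> space P" for \<omega>
    using \<alpha> by (simp add: X_eq[OF that])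
  define q where "q r = ?Q r" for r
  define e where "e = ?e"
  have e_nonneg: "0 \<le> e"
    by (simp add: e_def)
  \<comment> \<open>The constant \<open>C\<close> is the beta term at
    \<open>tot rs = tot ls = 0\<close>, as provided by \<open>Beta_term_bounds\<close>.\<close>
  have Q: "weighted_series (outer_pmf r) (outer_pmf (n - r)) (\<lambda>rs ls. ennreal (?T rs ls)) = ennreal (q r)" for r
    unfolding q_def by (rule weighted_series_ennreal[where C = "t powr \<alpha> * Beta 1 \<alpha>" and t = t])
      (rule outer_pmf_nonneg outer_pmf_le_1 Beta_term_bounds[OF t \<alpha>])+
  have Q_nonneg: "0 \<le> q r" for r
    unfolding q_def by (rule weighted_series_nonneg[where C = "t powr \<alpha> * Beta 1 \<alpha>" and t = t])
      (rule outer_pmf_nonneg outer_pmf_le_1 Beta_term_bounds[OF t \<alpha>])+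
  have W: "(\<integral>\<^sup>+ \<omega>. Y \<omega> * indicator ?A \<omega> \<partial>P) = ennreal (\<Sum>r=0..n. real r * (e * q r))"
    unfolding Y_def nn_integral_fractional_on_event[OF t \<alpha>] Q e_def[symmetric]
    using e_nonneg Q_nonneg by (simp add: ennreal_mult'[symmetric])
  \<comment> \<open>The integral of \<open>Y\<close> over the event is a real number by
    \<open>W\<close>, so \<open>Y\<close> is almost surely finite there and \<open>enn2real\<close>
    loses nothing.\<close>
  have finite: "AE \<omega> in P. Y \<omega> * indicator ?A \<omega> \<noteq> \<infinity>"
    by (rule nn_integral_PInf_AE) (auto simp: W)
  have "(\<integral>\<^sup>+ \<omega>. ennreal (X \<omega>) * indicator ?A \<omega> \<partial>P) =
      (\<integral>\<^sup>+ \<omega>. ennreal (1 / Gamma \<alpha>) * (Y \<omega> * indicator ?A \<omega>) \<partial>P)"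
  proof (rule nn_integral_cong_AE)
    show "AE \<omega> in P. ennreal (X \<omega>) * indicator ?A \<omega> =
        ennreal (1 / Gamma \<alpha>) * (Y \<omega> * indicator ?A \<omega>)"
      using finite AE_space
    proof eventually_elim
      case (elim \<omega>)
      show ?case
      proof (cases "\<omega> \<in> ?A")
        case True
        then have "ennreal (enn2real (Y \<omega>)) = Y \<omega>"
          using elim by (simp add: less_top)
        then show ?thesis
          using True \<alpha> by (simp add: X_eq ennreal_mult del: times_divide_eq_left)
      qed simp
    qed
  qed
  also have "\<dots> = ennreal (1 / Gamma \<alpha> * (\<Sum>r=0..n. real r * (e * q r)))"
    using \<alpha> by (simp add: nn_integral_cmult W ennreal_mult' del: times_divide_eq_left)
  finally have V: "(\<integral>\<^sup>+ \<omega>. ennreal (X \<omega>) * indicator ?A \<omega> \<partial>P) =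
      ennreal (1 / Gamma \<alpha> * (\<Sum>r=0..n. real r * (e * q r)))" .
  have "expectation_given_event P X ?A = enn2real (\<integral>\<^sup>+ \<omega>. ennreal (X \<omega>) \<partial>uniform_measure P ?A)"
    unfolding expectation_given_event_def
  proof (rule integral_eq_nn_integral)
    show "AE \<omega> in uniform_measure P ?A. 0 \<le> X \<omega>"
      by (rule AE_uniform_measureI) (auto simp: X_nonneg)
  qed measurable
  also have "\<dots> = enn2real ((\<integral>\<^sup>+ \<omega>. ennreal (X \<omega>) * indicator ?A \<omega> \<partial>P) / emeasure P ?A)"
    by (subst nn_integral_uniform_measure) simp_all
  \<comment> \<open>In the case of probability zero the numerator is an integral over a null set,
    and both sides are 0 under the convention for division by zero.\<close>
  also have "\<dots> = 1 / Gamma \<alpha> * (\<Sum>r=0..n. real r * (e * q r)) / ?pA"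
  proof (cases "?pA = 0")
    case True
    then have "(\<integral>\<^sup>+ \<omega>. ennreal (X \<omega>) * indicator ?A \<omega> \<partial>P) = 0"
      by (intro nn_integral_null_set) (simp add: null_sets_def outer.emeasure_eq_measure)
    then show ?thesis
      using True by simp
  next
    case False
    then have "0 < ?pA"
      by (simp add: zero_less_measure_iff)
    moreover have "0 \<le> 1 / Gamma \<alpha> * (\<Sum>r=0..n. real r * (e * q r))"
      using \<alpha> by (intro mult_nonneg_nonneg sum_nonneg Q_nonneg e_nonneg) simp_all
    ultimately show ?thesis
      by (simp only: V outer.emeasure_eq_measure divide_ennreal enn2real_ennreal divide_nonneg_pos)
  qed
  also have "\<dots> = 1 / Gamma \<alpha> * (\<Sum>r=0..n. real r * e / ?pA * q r)"
    unfolding times_divide_eq_right[symmetric, of "1 / Gamma \<alpha>"] sum_divide_distrib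
    by (intro arg_cong2[of _ _ _ _ "(*)"] sum.cong refl) simp
  finally show ?thesis
    unfolding X_def e_def q_def .
qed

end

theorem proposition3p7:
  fixes P :: "'a measure"
    and M0 M Mhat :: "real \<Rightarrow> 'a \<Rightarrow> nat"
    and Xhat :: "real \<Rightarrow> 'a \<Rightarrow> real"
    and k0 k n :: nat
    and \<mu> lam :: "nat \<Rightarrow> real"
    and \<alpha> t \<mu>tot :: real
  assumes "generalized_counting_process P k0 \<mu> M0"
    and "generalized_counting_process P k lam M"
    and "independent_processes P M0 M"
    and "Mhat = iterated_process M M0"
    and "\<mu>tot = (\<Sum>j=1..k0. \<mu> j)"
    and "0 < \<alpha>"
    and "\<And>t \<omega>. Xhat t \<omega> = riemann_liouville_integral \<alpha> (\<lambda>s. real (Mhat s \<omega>)) t"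
    and "0 < t"
  shows "expectation_given_event P (Xhat t) {\<omega> \<in> space P. Mhat t \<omega> = n} =
    1 / Gamma \<alpha> *
    (\<Sum>r=0..n. real r * exp (- \<mu>tot * t) / \<P>(\<omega> in P. Mhat t \<omega> = n) *
      (\<Sum>x. \<P>(\<omega> in P. M (real x) \<omega> = r) *
        (\<Sum>rs\<in>Omega k0 x. (\<Prod>j=1..k0. \<mu> j ^ rs j / fact (rs j)) *
          (\<Sum>y. \<P>(\<omega> in P. M (real y) \<omega> = n - r) *
            (\<Sum>ls\<in>Omega k0 y. (\<Prod>j=1..k0. \<mu> j ^ ls j / fact (ls j)) *
              (t powr (\<alpha> + real (\<Sum>j=1..k0. ls j) + real (\<Sum>j=1..k0. rs j)) *
               Beta (real (\<Sum>j=1..k0. rs j) + 1) (\<alpha> + real (\<Sum>j=1..k0. ls j))))))))"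
proof -
  interpret iterated_counting_process P k lam M k0 \<mu> M0
    using assms(1-3) by (intro iterated_counting_process.intro iterated_counting_process_axioms.intro)
  have Xhat: "Xhat t = (\<lambda>\<omega>. riemann_liouville_integral \<alpha> (\<lambda>s. real (iterated_process M M0 s \<omega>)) t)"
    using assms(4,7) by (simp add: fun_eq_iff)
  show ?thesis
    unfolding Xhat assms(4,5)
    using expectation_fractional_given_event[OF assms(8,6), of n] unfolding outer_pmf_def weight_def .
qed

end
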